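(* Let $A$ be a torsion-free (discrete) abelian group and $C$ a torsion (discrete) abelian group. Then $Ext_{t}(C,A)=0$.
   Context: All groups are discrete abelian groups. For a group $G$, $tG$ denotes its maximal torsion subgroup. $Ext(C,A)$ is the group of equivalence classes of extensions $0\to A\stackrel{\phi}{\to} B\stackrel{\psi}{\to} C\to 0$ (short exact sequences). Such an extension is a t-extension if the sequence of restricted maps $0\to tA\stackrel{\phi}{\to} tB\stackrel{\psi}{\to} tC\to 0$ is exact. $Ext_t(C,A)$ is the subgroup of $Ext(C,A)$ of elements represented by t-extensions; thus $Ext_t(C,A)=0$ means every t-extension of $A$ by $C$ splits. *)

theory Defs
  imports "HOL-Algebra.Exact_Sequence"
begin

section \<open>Torsion\<close>

definition torsion_part :: "('a, 'm) monoid_scheme \<Rightarrow> 'a set" where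
  "torsion_part G = {x \<in> carrier G. \<exists>n::nat. n > 0 \<and> x [^]\<^bsub>G\<^esub> n = \<one>\<^bsub>G\<^esub>}"

abbreviation torsion_subgroup :: "('a, 'm) monoid_scheme \<Rightarrow> ('a, 'm) monoid_scheme" where
  "torsion_subgroup G \<equiv> G\<lparr>carrier := torsion_part G\<rparr>"

definition torsion_group :: "('a, 'm) monoid_scheme \<Rightarrow> bool" where
  "torsion_group G \<longleftrightarrow> torsion_part G = carrier G"

definition torsion_free_group :: "('a, 'm) monoid_scheme \<Rightarrow> bool" where
  "torsion_free_group G \<longleftrightarrow> torsion_part G = {\<one>\<^bsub>G\<^esub>}"

section \<open>Extensions\<close>

text \<open>The library constant \<^const>\<open>short_exact_sequence\<close> forces all the groups to live on
  one type; here the three types are independent.\<close>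

definition short_exact ::
  "('a, 'm) monoid_scheme \<Rightarrow> ('b, 'k) monoid_scheme \<Rightarrow> ('c, 'n) monoid_scheme
    \<Rightarrow> ('a \<Rightarrow> 'b) \<Rightarrow> ('b \<Rightarrow> 'c) \<Rightarrow> bool" where
  "short_exact A B C \<phi> \<psi> \<longleftrightarrow>
     \<phi> \<in> mon A B \<and> \<psi> \<in> epi B C \<and> kernel B C \<psi> = \<phi> ` carrier A"

record ('a, 'b, 'c) extension =
  ext_mid :: "'b monoid"
  ext_inj :: "'a \<Rightarrow> 'b"
  ext_proj :: "'b \<Rightarrow> 'c"

definition is_extension ::
  "('a, 'm) monoid_scheme \<Rightarrow> ('c, 'n) monoid_scheme \<Rightarrow> ('a, 'b, 'c) extension \<Rightarrow> bool" where
  "is_extension A C E \<longleftrightarrow>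
     comm_group A \<and> comm_group (ext_mid E) \<and> comm_group C \<and>
     short_exact A (ext_mid E) C (ext_inj E) (ext_proj E)"

definition is_t_extension ::
  "('a, 'm) monoid_scheme \<Rightarrow> ('c, 'n) monoid_scheme \<Rightarrow> ('a, 'b, 'c) extension \<Rightarrow> bool" where
  "is_t_extension A C E \<longleftrightarrow>
     is_extension A C E \<and>
     short_exact (torsion_subgroup A) (torsion_subgroup (ext_mid E)) (torsion_subgroup C)
       (ext_inj E) (ext_proj E)"

definition ext_equiv ::
  "('a, 'm) monoid_scheme \<Rightarrow> ('c, 'n) monoid_scheme
    \<Rightarrow> ('a, 'b, 'c) extension \<Rightarrow> ('a, 'd, 'c) extension \<Rightarrow> bool" where
  "ext_equiv A C E E' \<longleftrightarrow>
     (\<exists>\<beta> \<in> iso (ext_mid E) (ext_mid E').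
        (\<forall>a \<in> carrier A. \<beta> (ext_inj E a) = ext_inj E' a) \<and>
        (\<forall>b \<in> carrier (ext_mid E). ext_proj E' (\<beta> b) = ext_proj E b))"

definition split_extension ::
  "('a, 'm) monoid_scheme \<Rightarrow> ('c, 'n) monoid_scheme \<Rightarrow> ('a, 'a \<times> 'c, 'c) extension" where
  "split_extension A C =
     \<lparr>ext_mid = A \<times>\<times> C, ext_inj = (\<lambda>a. (a, \<one>\<^bsub>C\<^esub>)), ext_proj = snd\<rparr>"

text \<open>The Baer sum: the pullback of the two projections modulo the antidiagonal copy of \<open>A\<close>.\<close>

definition baer_pullback ::
  "('a, 'b, 'c) extension \<Rightarrow> ('a, 'd, 'c) extension \<Rightarrow> ('b \<times> 'd) monoid" where
  "baer_pullback E E' =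
     (ext_mid E \<times>\<times> ext_mid E')\<lparr>carrier :=
        {(x, y) \<in> carrier (ext_mid E) \<times> carrier (ext_mid E'). ext_proj E x = ext_proj E' y}\<rparr>"

definition baer_antidiagonal ::
  "('a, 'm) monoid_scheme \<Rightarrow> ('a, 'b, 'c) extension \<Rightarrow> ('a, 'd, 'c) extension \<Rightarrow> ('b \<times> 'd) set" where
  "baer_antidiagonal A E E' =
     (\<lambda>a. (ext_inj E a, inv\<^bsub>ext_mid E'\<^esub> ext_inj E' a)) ` carrier A"

definition baer_sum ::
  "('a, 'm) monoid_scheme \<Rightarrow> ('a, 'b, 'c) extension \<Rightarrow> ('a, 'd, 'c) extension
    \<Rightarrow> ('a, ('b \<times> 'd) set, 'c) extension" where
  "baer_sum A E E' =
     \<lparr>ext_mid = baer_pullback E E' Mod baer_antidiagonal A E E',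
      ext_inj = (\<lambda>a. baer_antidiagonal A E E' #>\<^bsub>baer_pullback E E'\<^esub>
                       (ext_inj E a, \<one>\<^bsub>ext_mid E'\<^esub>)),
      ext_proj = (\<lambda>S. the_elem ((\<lambda>p. ext_proj E (fst p)) ` S))\<rparr>"

lemma is_extension_baer_sum:
  fixes E :: "('a, 'b, 'c) extension" and E' :: "('a, 'd, 'c) extension"
  assumes "is_extension A C E" and "is_extension A C E'"
  shows "is_extension A C (baer_sum A E E')"
proof -
  define B p q where "B = ext_mid E" and "p = ext_inj E" and "q = ext_proj E"
  define B' p' q' where "B' = ext_mid E'" and "p' = ext_inj E'" and "q' = ext_proj E'"
  note defs = B_def p_def q_def B'_def p'_def q'_def
  have cA: "comm_group A" and cC: "comm_group C"
    and cB: "comm_group B" and pm: "p \<in> mon A B" and qe: "q \<in> epi B C"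
    and ker: "kernel B C q = p ` carrier A"
    and cB': "comm_group B'" and pm': "p' \<in> mon A B'" and qe': "q' \<in> epi B' C"
    and ker': "kernel B' C q' = p' ` carrier A"
    using assms by (auto simp: is_extension_def short_exact_def defs)
  interpret A: comm_group A by fact
  interpret B: comm_group B by fact
  interpret B': comm_group B' by fact
  interpret C: comm_group C by fact
  have pinj: "inj_on p (carrier A)" and pinj': "inj_on p' (carrier A)"
    using pm pm' by (auto simp: mon_def)
  have qs: "q ` carrier B = carrier C" and qs': "q' ` carrier B' = carrier C"
    using qe qe' by (auto simp: epi_def)
  interpret p: group_hom A B p using pm by unfold_locales (simp add: mon_def)
  interpret p': group_hom A B' p' using pm' by unfold_locales (simp add: mon_def)
  interpret q: group_hom B C q using qe by unfold_locales (simp add: epi_def)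
  interpret q': group_hom B' C q' using qe' by unfold_locales (simp add: epi_def)
  have qp: "q (p a) = \<one>\<^bsub>C\<^esub>" and qp': "q' (p' a) = \<one>\<^bsub>C\<^esub>" if "a \<in> carrier A" for a
    using ker ker' that by (auto simp: kernel_def)
  define P where "P = baer_pullback E E'"
  define D where "D = baer_antidiagonal A E E'"
  let ?S = "{(x, y) \<in> carrier B \<times> carrier B'. q x = q' y}"
  have P: "P = (B \<times>\<times> B')\<lparr>carrier := ?S\<rparr>"
    by (simp add: P_def baer_pullback_def defs)
  have D: "D = (\<lambda>a. (p a, inv\<^bsub>B'\<^esub> p' a)) ` carrier A"
    by (simp add: D_def baer_antidiagonal_def defs)
  have Psimps: "carrier P = ?S" "\<one>\<^bsub>P\<^esub> = (\<one>\<^bsub>B\<^esub>, \<one>\<^bsub>B'\<^esub>)"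
    "\<And>u v u' v'. (u, v) \<otimes>\<^bsub>P\<^esub> (u', v') = (u \<otimes>\<^bsub>B\<^esub> u', v \<otimes>\<^bsub>B'\<^esub> v')"
    by (auto simp: P)
  have cP: "comm_group P"
  proof (rule comm_groupI)
    show "\<exists>y\<in>carrier P. y \<otimes>\<^bsub>P\<^esub> x = \<one>\<^bsub>P\<^esub>" if "x \<in> carrier P" for x
      using that by (intro bexI[of _ "(inv\<^bsub>B\<^esub> fst x, inv\<^bsub>B'\<^esub> snd x)"]) (auto simp: Psimps)
  qed (auto simp: Psimps B.m_ac B'.m_ac)
  interpret P: comm_group P by fact
  have invP: "inv\<^bsub>P\<^esub> (u, v) = (inv\<^bsub>B\<^esub> u, inv\<^bsub>B'\<^esub> v)" if "(u, v) \<in> carrier P" for u v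
    using that by (intro P.inv_equality) (auto simp: Psimps)
  have DP: "subgroup D P"
  proof (rule P.subgroupI)
    show "D \<subseteq> carrier P" by (auto simp: D Psimps qp qp')
    show "D \<noteq> {}" by (auto simp: D)
    show "inv\<^bsub>P\<^esub> d \<in> D" if dD: "d \<in> D" for d
    proof -
      obtain a where a: "a \<in> carrier A" "d = (p a, inv\<^bsub>B'\<^esub> p' a)" using dD by (auto simp: D)
      have "inv\<^bsub>P\<^esub> d = (p (inv\<^bsub>A\<^esub> a), inv\<^bsub>B'\<^esub> p' (inv\<^bsub>A\<^esub> a))"
        unfolding a(2) using a(1) by (subst invP) (auto simp: Psimps qp qp')
      thus ?thesis unfolding D by (rule image_eqI) (simp add: a(1))
    qed
    show "d \<otimes>\<^bsub>P\<^esub> d' \<in> D" if "d \<in> D" "d' \<in> D" for d d'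
    proof -
      obtain a b where a: "a \<in> carrier A" "d = (p a, inv\<^bsub>B'\<^esub> p' a)"
        and b: "b \<in> carrier A" "d' = (p b, inv\<^bsub>B'\<^esub> p' b)" using \<open>d \<in> D\<close> \<open>d' \<in> D\<close> by (auto simp: D)
      have "d \<otimes>\<^bsub>P\<^esub> d' = (p (a \<otimes>\<^bsub>A\<^esub> b), inv\<^bsub>B'\<^esub> p' (a \<otimes>\<^bsub>A\<^esub> b))"
        unfolding a(2) b(2) using a(1) b(1) by (simp add: Psimps B'.inv_mult)
      thus ?thesis unfolding D by (rule image_eqI) (simp add: a(1) b(1))
    qed
  qed
  have nD: "D \<lhd> P" using DP by (simp add: P.subgroup_imp_normal)
  interpret D: normal D P by fact
  define M where "M = P Mod D"
  have cM: "comm_group M" unfolding M_def using P.abelian_FactGroup[OF DP] .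
  have Mc: "carrier M = (\<lambda>x. D #>\<^bsub>P\<^esub> x) ` carrier P"
    by (auto simp: M_def FactGroup_def RCOSETS_def)
  have Mm: "(D #>\<^bsub>P\<^esub> x) \<otimes>\<^bsub>M\<^esub> (D #>\<^bsub>P\<^esub> y) = D #>\<^bsub>P\<^esub> (x \<otimes>\<^bsub>P\<^esub> y)"
    if "x \<in> carrier P" "y \<in> carrier P" for x y
    using that by (simp add: M_def FactGroup_def D.rcos_sum)
  have M1: "\<one>\<^bsub>M\<^esub> = D" by (simp add: M_def FactGroup_def)
  define i where "i = (\<lambda>a. D #>\<^bsub>P\<^esub> (p a, \<one>\<^bsub>B'\<^esub>))"
  define r where "r = (\<lambda>S :: ('b \<times> 'd) set. the_elem ((\<lambda>u. q (fst u)) ` S))"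
  have r: "r (D #>\<^bsub>P\<^esub> u) = q (fst u)" if "u \<in> carrier P" for u
  proof -
    have "(\<lambda>u. q (fst u)) ` (D #>\<^bsub>P\<^esub> u) = {q (fst u)}"
      using that by (force simp: r_coset_def D Psimps qp)
    thus ?thesis by (simp add: r_def)
  qed
  have ic: "(p a, \<one>\<^bsub>B'\<^esub>) \<in> carrier P" if "a \<in> carrier A" for a
    using that by (simp add: Psimps qp)
  have ih: "i \<in> hom A M"
    by (rule homI) (auto simp: i_def Mc ic Mm, auto simp: Psimps)
  have rh: "r \<in> hom M C"
  proof (rule homI)
    show "r x \<in> carrier C" if "x \<in> carrier M" for x
      using that by (auto simp: Mc r) (auto simp: Psimps)
    show "r (x \<otimes>\<^bsub>M\<^esub> y) = r x \<otimes>\<^bsub>C\<^esub> r y" if xy: "x \<in> carrier M" "y \<in> carrier M" for x y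
    proof -
      obtain u v where "u \<in> carrier P" "v \<in> carrier P" "x = D #>\<^bsub>P\<^esub> u" "y = D #>\<^bsub>P\<^esub> v"
        using xy by (auto simp: Mc)
      moreover have "q (fst (u \<otimes>\<^bsub>P\<^esub> v)) = q (fst u) \<otimes>\<^bsub>C\<^esub> q (fst v)"
        using calculation by (cases u; cases v) (simp add: Psimps)
      ultimately show ?thesis by (simp add: Mm r)
    qed
  qed
  have coset1: "D #>\<^bsub>P\<^esub> u = D \<longleftrightarrow> u \<in> D" if "u \<in> carrier P" for u
    using that D.rcos_const[OF P.is_group] P.coset_join1[OF _ _ DP] by blast
  interpret M: comm_group M by fact
  interpret i: group_hom A M i by unfold_locales (rule ih)
  have im: "i \<in> mon A M"
  proof -
    have "a = \<one>\<^bsub>A\<^esub>" if a: "a \<in> carrier A" "i a = \<one>\<^bsub>M\<^esub>" for a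
    proof -
      have "(p a, \<one>\<^bsub>B'\<^esub>) \<in> D" using a coset1 ic by (auto simp: i_def M1)
      then obtain b where b: "b \<in> carrier A" "p a = p b" "\<one>\<^bsub>B'\<^esub> = inv\<^bsub>B'\<^esub> p' b"
        unfolding D by blast
      have "p' b = p' \<one>\<^bsub>A\<^esub>" using b by (metis B'.inv_eq_1_iff p'.hom_closed p'.hom_one)
      with pinj' have "b = \<one>\<^bsub>A\<^esub>" using b(1) by (rule inj_onD) simp
      with pinj b(2) show ?thesis using a(1) b(1) by (metis inj_onD)
    qed
    thus ?thesis using ih i.inj_on_one_iff by (auto simp: mon_def)
  qed
  have re: "r \<in> epi M C"
  proof -
    have "c \<in> r ` carrier M" if c: "c \<in> carrier C" for c
    proof -
      obtain x y where xy: "x \<in> carrier B" "y \<in> carrier B'" "q x = c" "q' y = c"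
        using c qs qs' by (metis imageE)
      hence "(x, y) \<in> carrier P" by (simp add: Psimps)
      thus ?thesis using r[of "(x, y)"] xy by (force simp: Mc)
    qed
    moreover have "r ` carrier M \<subseteq> carrier C" using rh by (auto simp: hom_def)
    ultimately show ?thesis using rh by (auto simp: epi_def)
  qed
  have kr: "kernel M C r = i ` carrier A"
  proof
    show "kernel M C r \<subseteq> i ` carrier A"
    proof
      fix S assume "S \<in> kernel M C r"
      then obtain u where u: "u \<in> carrier P" "S = D #>\<^bsub>P\<^esub> u" "r S = \<one>\<^bsub>C\<^esub>"
        by (auto simp: kernel_def Mc)
      obtain x y where xy: "u = (x, y)" by (cases u)
      have "x \<in> kernel B C q" "y \<in> kernel B' C q'"
        using u r[of u] by (auto simp: xy kernel_def Psimps)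
      then obtain a b where ab: "a \<in> carrier A" "x = p a" "b \<in> carrier A" "y = p' b"
        using ker ker' by auto
      let ?v = "(p (a \<otimes>\<^bsub>A\<^esub> b), \<one>\<^bsub>B'\<^esub>)"
      have "(p b, inv\<^bsub>B'\<^esub> p' b) \<otimes>\<^bsub>P\<^esub> u = ?v"
        using ab by (simp add: xy Psimps B.m_comm A.m_comm)
      hence "?v \<in> D #>\<^bsub>P\<^esub> u" using ab(3) by (force simp: r_coset_def D)
      hence "S = D #>\<^bsub>P\<^esub> ?v" using P.repr_independence u DP by metis
      hence "S = i (a \<otimes>\<^bsub>A\<^esub> b)" by (simp only: i_def)
      thus "S \<in> i ` carrier A" using ab(1,3) by blast
    qed
    show "i ` carrier A \<subseteq> kernel M C r"
      using r ic ih by (auto simp: kernel_def i_def Mc qp)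
  qed
  have "baer_sum A E E' = \<lparr>ext_mid = M, ext_inj = i, ext_proj = r\<rparr>"
    by (simp add: baer_sum_def M_def i_def r_def P_def D_def defs)
  thus ?thesis using cA cC cM im re kr by (simp add: is_extension_def short_exact_def)
qed

section \<open>The groups Ext and t-Ext\<close>

text \<open>The middle group of an extension of \<open>A\<close> by \<open>C\<close> is, as a set, in bijection with the product
  of the carriers. Hence every extension, on whatever type, is equivalent to one whose middle group
  lives on the type \<open>'a \<times> 'c\<close> (lemma \<open>ext_representable\<close> below), and \<open>Ext\<close> consists of
  the equivalence classes of extensions on that type.\<close>

definition ext_rel ::
  "('c, 'n) monoid_scheme \<Rightarrow> ('a, 'm) monoid_scheme \<Rightarrow> ('a, 'a \<times> 'c, 'c) extension rel" where
  "ext_rel C A = {(E, E'). is_extension A C E \<and> is_extension A C E' \<and> ext_equiv A C E E'}"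

definition Ext ::
  "('c, 'n) monoid_scheme \<Rightarrow> ('a, 'm) monoid_scheme \<Rightarrow> ('a, 'a \<times> 'c, 'c) extension set monoid" where
  "Ext C A =
     \<lparr>carrier = {E. is_extension A C E} // ext_rel C A,
      mult = (\<lambda>S T. {E. is_extension A C E \<and>
                        (\<exists>E1 \<in> S. \<exists>E2 \<in> T. ext_equiv A C E (baer_sum A E1 E2))}),
      one = ext_rel C A `` {split_extension A C}\<rparr>"

definition Ext_t ::
  "('c, 'n) monoid_scheme \<Rightarrow> ('a, 'm) monoid_scheme \<Rightarrow> ('a, 'a \<times> 'c, 'c) extension set monoid" where
  "Ext_t C A = (Ext C A)\<lparr>carrier := {S \<in> carrier (Ext C A). \<exists>E \<in> S. is_t_extension A C E}\<rparr>"

lemma ext_representable: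
  fixes E :: "('a, 'b, 'c) extension"
  assumes "is_extension A C E"
  shows "\<exists>E' :: ('a, 'a \<times> 'c, 'c) extension. is_extension A C E' \<and> ext_equiv A C E E'"
proof -
  define B where "B = ext_mid E"
  define p where "p = ext_inj E"
  define q where "q = ext_proj E"
  have cA: "comm_group A" and cB: "comm_group B" and cC: "comm_group C"
    and pm: "p \<in> mon A B" and qe: "q \<in> epi B C" and ker: "kernel B C q = p ` carrier A"
    using assms by (auto simp: is_extension_def short_exact_def B_def p_def q_def)
  interpret A: comm_group A by fact
  interpret B: comm_group B by fact
  interpret C: comm_group C by fact
  have ph: "p \<in> hom A B" and pinj: "inj_on p (carrier A)" using pm by (auto simp: mon_def)
  have qh: "q \<in> hom B C" and qs: "q ` carrier B = carrier C" using qe by (auto simp: epi_def)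
  interpret p: group_hom A B p by unfold_locales (rule ph)
  interpret q: group_hom B C q by unfold_locales (rule qh)
  define s where "s = inv_into (carrier B) q"
  have s: "s c \<in> carrier B" "q (s c) = c" if "c \<in> carrier C" for c
    using that qs by (auto simp: s_def inv_into_into f_inv_into_f)
  have qp: "q (p a) = \<one>\<^bsub>C\<^esub>" if "a \<in> carrier A" for a
    using ker that by (auto simp: kernel_def)
  define f where "f = (\<lambda>(a, c). p a \<otimes>\<^bsub>B\<^esub> s c)"
  let ?S = "carrier A \<times> carrier C"
  have inj: "inj_on f ?S"
  proof (rule inj_onI, clarify)
    fix a c a' c'
    assume m: "a \<in> carrier A" "c \<in> carrier C" "a' \<in> carrier A" "c' \<in> carrier C"
      and e: "f (a, c) = f (a', c')"
    have "q (f (a, c)) = c" "q (f (a', c')) = c'" using m s qp by (auto simp: f_def)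
    hence cc: "c = c'" using e by simp
    hence "p a = p a'" using e m s by (auto simp: f_def)
    thus "a = a' \<and> c = c'" using cc pinj m by (auto dest: inj_onD)
  qed
  have img: "f ` ?S = carrier B"
  proof
    show "f ` ?S \<subseteq> carrier B" using s by (auto simp: f_def)
    show "carrier B \<subseteq> f ` ?S"
    proof
      fix b assume b: "b \<in> carrier B"
      let ?d = "b \<otimes>\<^bsub>B\<^esub> inv\<^bsub>B\<^esub> s (q b)"
      have "?d \<in> kernel B C q" using b s by (auto simp: kernel_def)
      then obtain a where a: "a \<in> carrier A" "?d = p a" using ker by auto
      have "f (a, q b) = ?d \<otimes>\<^bsub>B\<^esub> s (q b)" by (simp add: f_def a(2))
      also have "\<dots> = b" using b s(1)[of "q b"] by (simp add: B.m_assoc)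
      finally show "b \<in> f ` ?S" using a(1) b by (intro image_eqI[of _ _ "(a, q b)"]) simp_all
    qed
  qed
  define g where "g = inv_into ?S f"
  have gf: "g (f x) = x" if "x \<in> ?S" for x
    unfolding g_def by (rule inv_into_f_f[OF inj that])
  have fg: "f (g b) = b" "g b \<in> ?S" if "b \<in> carrier B" for b
    unfolding g_def using that img[symmetric] by (simp_all only: f_inv_into_f inv_into_into)
  have fS: "f x \<in> carrier B" if "x \<in> ?S" for x using imageI[OF that, of f] by (simp only: img)
  define D where "D = \<lparr>carrier = ?S, mult = (\<lambda>x y. g (f x \<otimes>\<^bsub>B\<^esub> f y)), one = g \<one>\<^bsub>B\<^esub>\<rparr>"
  have Dsimps: "carrier D = ?S" "\<one>\<^bsub>D\<^esub> = g \<one>\<^bsub>B\<^esub>" "\<And>x y. x \<otimes>\<^bsub>D\<^esub> y = g (f x \<otimes>\<^bsub>B\<^esub> f y)"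
    by (auto simp: D_def)
  have cD: "comm_group D"
  proof (rule comm_groupI, goal_cases)
    case (1 x y) then show ?case using fg fS by (simp only: Dsimps B.m_closed)
  next
    case 2 show ?case by (simp only: Dsimps fg B.one_closed)
  next
    case (3 x y z) then show ?case using fS by (simp only: Dsimps fg B.m_closed B.m_assoc)
  next
    case (4 x y) then show ?case using fS by (simp only: Dsimps B.m_comm)
  next
    case (5 x) then show ?case using fS gf by (simp only: Dsimps fg B.one_closed B.l_one)
  next
    case (6 x)
    then have "f x \<in> carrier B" using fS by (simp only: Dsimps)
    then have "g (inv\<^bsub>B\<^esub> f x) \<otimes>\<^bsub>D\<^esub> x = \<one>\<^bsub>D\<^esub>" "g (inv\<^bsub>B\<^esub> f x) \<in> carrier D"
      by (simp_all only: Dsimps fg B.inv_closed B.l_inv)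
    then show ?case by blast
  qed
  have gi: "g \<in> iso B D"
  proof -
    have "bij_betw g (carrier B) (carrier D)"
      unfolding g_def Dsimps by (rule bij_betw_inv_into) (use inj img in \<open>simp add: bij_betw_def\<close>)
    moreover have "g \<in> hom B D"
      by (rule homI) (simp_all only: Dsimps fg)
    ultimately show ?thesis by (simp add: iso_def)
  qed
  define E' where "E' = \<lparr>ext_mid = D, ext_inj = g \<circ> p, ext_proj = q \<circ> f\<rparr>"
  have "ext_equiv A C E E'"
    unfolding ext_equiv_def E'_def using gi fg by (auto simp: B_def p_def q_def)
  moreover have "is_extension A C E'"
  proof -
    have 1: "g \<circ> p \<in> mon A D"
    proof -
      have "g \<circ> p \<in> hom A D" using hom_compose[OF ph] gi by (auto simp: iso_def)
      moreover have "inj_on (g \<circ> p) (carrier A)"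
        using pinj fg(1) p.hom_closed unfolding inj_on_def o_def by metis
      ultimately show ?thesis by (simp add: mon_def)
    qed
    have 2: "q \<circ> f \<in> epi D C"
    proof -
      have "q \<circ> f \<in> hom D C"
        by (rule homI) (simp_all only: Dsimps o_def fg fS B.m_closed q.hom_closed q.hom_mult)
      moreover have "(q \<circ> f) ` carrier D = carrier C"
        using img qs by (simp only: Dsimps image_comp[symmetric])
      ultimately show ?thesis by (simp add: epi_def)
    qed
    have 3: "kernel D C (q \<circ> f) = (g \<circ> p) ` carrier A"
    proof -
      have "kernel D C (q \<circ> f) = g ` kernel B C q"
      proof
        show "kernel D C (q \<circ> f) \<subseteq> g ` kernel B C q"
        proof
          fix x assume x: "x \<in> kernel D C (q \<circ> f)"
          hence "x \<in> ?S" "q (f x) = \<one>\<^bsub>C\<^esub>" by (auto simp: kernel_def Dsimps)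
          hence "f x \<in> kernel B C q" "x = g (f x)" using fS gf by (simp_all add: kernel_def)
          thus "x \<in> g ` kernel B C q" by blast
        qed
        show "g ` kernel B C q \<subseteq> kernel D C (q \<circ> f)"
          by (rule image_subsetI) (simp add: kernel_def Dsimps(1) fg del: mem_Sigma_iff)
      qed
      thus ?thesis by (simp add: ker image_comp)
    qed
    show ?thesis using cA cC cD 1 2 3 by (simp add: is_extension_def short_exact_def E'_def)
  qed
  ultimately show ?thesis by blast
qed

end

theory Submission
  imports Defs
begin

text \<open>Let \<open>E\<close> be a t-extension of the torsion-free group \<open>A\<close> by the torsion group \<open>C\<close>, with
  middle group \<open>B\<close>, inclusion \<open>\<phi>\<close> and projection \<open>\<psi>\<close>. Exactness on torsion parts says that
  \<open>\<psi>\<close> maps \<open>tB\<close> onto \<open>tC = C\<close> with kernel the image of \<open>tA = 0\<close>. So it is an isomorphism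
  from \<open>tB\<close> onto \<open>C\<close>, and its inverse is a homomorphic section of \<open>\<psi>\<close>
  (\<open>t_extension_section\<close>). An extension with a homomorphic section \<open>s\<close> is equivalent to the
  direct sum via \<open>(a, c) \<mapsto> \<phi> a \<cdot> s c\<close> (\<open>split_extension_equiv_if_section\<close>), so \<open>E\<close>
  represents the zero class. Conversely, the zero class does lie in t-Ext, because the
  torsion part of a direct sum is the direct sum of the torsion parts
  (\<open>is_t_extension_split_extension\<close>).\<close>

section \<open>Torsion parts\<close>

lemma (in comm_group) subgroup_torsion_part: "subgroup (torsion_part G) G"
proof (rule subgroupI)
  show "torsion_part G \<subseteq> carrier G" by (auto simp: torsion_part_def)
  have "\<one> [^] (1::nat) = \<one>" by simp
  then show "torsion_part G \<noteq> {}" by (force simp: torsion_part_def)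
next
  fix x assume "x \<in> torsion_part G"
  then show "inv x \<in> torsion_part G"
    by (auto simp: torsion_part_def nat_pow_inv)
next
  fix x y assume "x \<in> torsion_part G" "y \<in> torsion_part G"
  then obtain m n :: nat where x: "x \<in> carrier G" "m > 0" "x [^] m = \<one>"
    and y: "y \<in> carrier G" "n > 0" "y [^] n = \<one>"
    by (auto simp: torsion_part_def)
  have "(x \<otimes> y) [^] (m * n) = (x [^] m) [^] n \<otimes> (y [^] n) [^] m"
    using x(1) y(1) by (simp add: pow_mult_distrib m_comm nat_pow_pow mult.commute)
  also have "\<dots> = \<one>" using x y by simp
  finally show "x \<otimes> y \<in> torsion_part G"
    using x y unfolding torsion_part_def by (auto intro!: exI[of _ "m * n"])
qed

lemma DirProd_nat_pow: "(a, c) [^]\<^bsub>G \<times>\<times> H\<^esub> (n::nat) = (a [^]\<^bsub>G\<^esub> n, c [^]\<^bsub>H\<^esub> n)"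
  by (induction n) (simp_all add: nat_pow_def)

lemma torsion_part_DirProd:
  assumes "group G" "group H"
  shows "torsion_part (G \<times>\<times> H) = torsion_part G \<times> torsion_part H"
proof -
  interpret G: group G by fact
  interpret H: group H by fact
  have "(a, c) \<in> torsion_part (G \<times>\<times> H)"
    if ac: "a \<in> torsion_part G" "c \<in> torsion_part H" for a c
  proof -
    obtain m n :: nat where a: "a \<in> carrier G" "m > 0" "a [^]\<^bsub>G\<^esub> m = \<one>\<^bsub>G\<^esub>"
      and c: "c \<in> carrier H" "n > 0" "c [^]\<^bsub>H\<^esub> n = \<one>\<^bsub>H\<^esub>"
      using ac by (auto simp: torsion_part_def)
    have "a [^]\<^bsub>G\<^esub> (m * n) = \<one>\<^bsub>G\<^esub>"
      using a by (simp flip: G.nat_pow_pow)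
    moreover have "c [^]\<^bsub>H\<^esub> (m * n) = \<one>\<^bsub>H\<^esub>"
      using c by (simp add: mult.commute[of m] flip: H.nat_pow_pow)
    ultimately show ?thesis
      using a c by (auto simp: torsion_part_def DirProd_nat_pow intro!: exI[of _ "m * n"])
  qed
  moreover have "torsion_part (G \<times>\<times> H) \<subseteq> torsion_part G \<times> torsion_part H"
    by (auto simp: torsion_part_def DirProd_nat_pow)
  ultimately show ?thesis by blast
qed

section \<open>Equivalence of extensions\<close>

lemma ext_equiv_refl: "ext_equiv A C E E"
  unfolding ext_equiv_def by (rule bexI[OF _ iso_set_refl]) simp

lemma ext_equiv_sym:
  assumes E: "is_extension A C E" and eq: "ext_equiv A C E E'"
  shows "ext_equiv A C E' E"
proof -
  let ?B = "carrier (ext_mid E)" and ?B' = "carrier (ext_mid E')"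
  interpret B: comm_group "ext_mid E" using E by (simp add: is_extension_def)
  obtain \<beta> where \<beta>: "\<beta> \<in> iso (ext_mid E) (ext_mid E')"
    and inj: "\<forall>a \<in> carrier A. \<beta> (ext_inj E a) = ext_inj E' a"
    and proj: "\<forall>b \<in> ?B. ext_proj E' (\<beta> b) = ext_proj E b"
    using eq by (auto simp: ext_equiv_def)
  let ?\<gamma> = "inv_into ?B \<beta>"
  have bij: "bij_betw \<beta> ?B ?B'" using \<beta> by (simp add: iso_def)
  have "?\<gamma> \<in> iso (ext_mid E') (ext_mid E)" using \<beta> by (rule B.iso_set_sym)
  moreover have "?\<gamma> (ext_inj E' a) = ext_inj E a" if a: "a \<in> carrier A" for a
  proof -
    have "ext_inj E a \<in> ?B"
      using E a by (auto simp: is_extension_def short_exact_def mon_def hom_def)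
    then show ?thesis
      using inj a bij by (metis bij_betw_inv_into_left)
  qed
  moreover have "ext_proj E (?\<gamma> b) = ext_proj E' b" if b: "b \<in> ?B'" for b
    using proj b bij by (metis bij_betw_def bij_betw_inv_into_right inv_into_into)
  ultimately show ?thesis unfolding ext_equiv_def by blast
qed

lemma ext_equiv_trans:
  assumes "ext_equiv A C E E'" "ext_equiv A C E' E''"
  shows "ext_equiv A C E E''"
proof -
  obtain \<beta> \<gamma> where \<beta>: "\<beta> \<in> iso (ext_mid E) (ext_mid E')"
    "\<forall>a \<in> carrier A. \<beta> (ext_inj E a) = ext_inj E' a"
    "\<forall>b \<in> carrier (ext_mid E). ext_proj E' (\<beta> b) = ext_proj E b"
    and \<gamma>: "\<gamma> \<in> iso (ext_mid E') (ext_mid E'')"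
    "\<forall>a \<in> carrier A. \<gamma> (ext_inj E' a) = ext_inj E'' a"
    "\<forall>b \<in> carrier (ext_mid E'). ext_proj E'' (\<gamma> b) = ext_proj E' b"
    using assms by (auto simp: ext_equiv_def)
  have "\<gamma> \<circ> \<beta> \<in> iso (ext_mid E) (ext_mid E'')"
    using \<beta>(1) \<gamma>(1) by (rule iso_set_trans)
  moreover have "\<beta> b \<in> carrier (ext_mid E')" if "b \<in> carrier (ext_mid E)" for b
    using \<beta>(1) that by (auto simp: iso_def hom_def)
  ultimately show ?thesis
    unfolding ext_equiv_def using \<beta>(2,3) \<gamma>(2,3) by (intro bexI[of _ "\<gamma> \<circ> \<beta>"]) auto
qed

lemma equiv_ext_rel: "equiv {E. is_extension A C E} (ext_rel C A)"
proof (rule equivI)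
  show "ext_rel C A \<subseteq> {E. is_extension A C E} \<times> {E. is_extension A C E}"
    by (auto simp: ext_rel_def)
  show "refl_on {E. is_extension A C E} (ext_rel C A)"
    by (auto simp: refl_on_def ext_rel_def ext_equiv_refl)
  show "sym (ext_rel C A)"
    by (auto simp: sym_def ext_rel_def intro: ext_equiv_sym)
  show "trans (ext_rel C A)"
    by (auto simp: trans_def ext_rel_def intro: ext_equiv_trans)
qed

section \<open>Split extensions\<close>

lemma short_exact_DirProd:
  assumes "group A" "group C"
  shows "short_exact A (A \<times>\<times> C) C (\<lambda>a. (a, \<one>\<^bsub>C\<^esub>)) snd"
proof -
  interpret A: group A by fact
  interpret C: group C by fact
  have "(\<lambda>a. (a, \<one>\<^bsub>C\<^esub>)) \<in> mon A (A \<times>\<times> C)"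
    by (auto simp: mon_def inj_on_def intro!: homI)
  moreover have "snd \<in> epi (A \<times>\<times> C) C"
  proof -
    have "carrier A \<noteq> {}" by blast
    then show ?thesis by (auto simp: epi_def intro!: homI)
  qed
  moreover have "kernel (A \<times>\<times> C) C snd = (\<lambda>a. (a, \<one>\<^bsub>C\<^esub>)) ` carrier A"
    by (auto simp: kernel_def)
  ultimately show ?thesis by (simp add: short_exact_def)
qed

lemma is_extension_split_extension:
  assumes "comm_group A" "comm_group C"
  shows "is_extension A C (split_extension A C)"
proof -
  interpret A: comm_group A by fact
  interpret C: comm_group C by fact
  have "comm_group (A \<times>\<times> C)"
    by (rule group.group_comm_groupI)
      (auto simp: DirProd_group A.is_group C.is_group A.m_comm C.m_comm)
  then show ?thesis
    using assms short_exact_DirProd[OF A.is_group C.is_group]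
    by (simp add: is_extension_def split_extension_def)
qed

text \<open>Since torsion parts commute with direct sums, the sequence of torsion parts is again a
  split sequence, now of the torsion subgroups.\<close>

lemma is_t_extension_split_extension:
  assumes "comm_group A" "comm_group C"
  shows "is_t_extension A C (split_extension A C)"
proof -
  interpret A: comm_group A by fact
  interpret C: comm_group C by fact
  have "torsion_subgroup A \<times>\<times> torsion_subgroup C = torsion_subgroup (A \<times>\<times> C)"
    by (simp add: torsion_part_DirProd A.is_group C.is_group) (simp add: DirProd_def)
  moreover have "short_exact (torsion_subgroup A) (torsion_subgroup A \<times>\<times> torsion_subgroup C)
      (torsion_subgroup C) (\<lambda>a. (a, \<one>\<^bsub>C\<^esub>)) snd"
    using short_exact_DirProd[OF A.subgroup_imp_group C.subgroup_imp_group,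
        OF A.subgroup_torsion_part C.subgroup_torsion_part]
    by simp
  ultimately show ?thesis
    using is_extension_split_extension[OF assms]
    by (simp add: is_t_extension_def split_extension_def)
qed

text \<open>A homomorphic section \<open>s\<close> of the projection \<open>\<psi>\<close> presents the middle group as the
  internal direct sum of the images of the inclusion \<open>\<phi>\<close> and of \<open>s\<close>: the component of \<open>b\<close>
  in the second is \<open>s (\<psi> b)\<close>, and the quotient of \<open>b\<close> by it is killed by \<open>\<psi>\<close>, hence in
  the image of \<open>\<phi>\<close>.\<close>

lemma split_extension_equiv_if_section:
  assumes E: "is_extension A C E"
    and s: "s \<in> hom C (ext_mid E)" and right_inv: "\<And>c. c \<in> carrier C \<Longrightarrow> ext_proj E (s c) = c"
  shows "ext_equiv A C (split_extension A C) E"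
proof -
  define B p q where "B = ext_mid E" and "p = ext_inj E" and "q = ext_proj E"
  note defs = B_def p_def q_def
  have groups: "comm_group A" "comm_group B" "comm_group C"
    and p: "p \<in> hom A B" "inj_on p (carrier A)" and q: "q \<in> hom B C"
    and ker: "kernel B C q = p ` carrier A"
    using E by (auto simp: is_extension_def short_exact_def mon_def epi_def defs)
  interpret A: comm_group A by fact
  interpret B: comm_group B by fact
  interpret C: comm_group C by fact
  interpret p: group_hom A B p by unfold_locales (rule p)
  interpret q: group_hom B C q by unfold_locales (rule q)
  interpret s: group_hom C B s by unfold_locales (use s in \<open>simp add: B_def\<close>)
  have qs: "q (s c) = c" if "c \<in> carrier C" for c
    using right_inv that by (simp add: q_def)
  have qp: "q (p a) = \<one>\<^bsub>C\<^esub>" if "a \<in> carrier A" for a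
    using ker that by (auto simp: kernel_def)
  define f where "f = (\<lambda>(a, c). p a \<otimes>\<^bsub>B\<^esub> s c)"
  have qf: "q (f (a, c)) = c" if "a \<in> carrier A" "c \<in> carrier C" for a c
    using that by (simp add: f_def qs qp)
  have "f \<in> hom (A \<times>\<times> C) B"
    by (rule homI) (auto simp: f_def B.m_ac)
  moreover have "inj_on f (carrier A \<times> carrier C)"
  proof (rule inj_onI, clarify)
    fix a c a' c'
    assume m: "a \<in> carrier A" "c \<in> carrier C" "a' \<in> carrier A" "c' \<in> carrier C"
      and e: "f (a, c) = f (a', c')"
    have "c = c'" using e qf m by metis
    moreover have "p a = p a'" using e m \<open>c = c'\<close> by (simp add: f_def)
    ultimately show "a = a' \<and> c = c'" using p(2) m by (auto dest: inj_onD)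
  qed
  moreover have "f ` (carrier A \<times> carrier C) = carrier B"
  proof
    show "f ` (carrier A \<times> carrier C) \<subseteq> carrier B" by (auto simp: f_def)
    show "carrier B \<subseteq> f ` (carrier A \<times> carrier C)"
    proof
      fix b assume b: "b \<in> carrier B"
      have "b \<otimes>\<^bsub>B\<^esub> inv\<^bsub>B\<^esub> s (q b) \<in> kernel B C q"
        using b by (simp add: kernel_def qs)
      then obtain a where a: "a \<in> carrier A" "b \<otimes>\<^bsub>B\<^esub> inv\<^bsub>B\<^esub> s (q b) = p a"
        using ker by auto
      have "f (a, q b) = b"
        unfolding f_def using b by (simp add: a(2)[symmetric] B.m_assoc)
      then show "b \<in> f ` (carrier A \<times> carrier C)"
        using a(1) b by (intro image_eqI[of _ _ "(a, q b)"]) simp_all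
    qed
  qed
  ultimately have "f \<in> iso (A \<times>\<times> C) B" by (simp add: iso_def bij_betw_def)
  moreover have "\<forall>a \<in> carrier A. f (a, \<one>\<^bsub>C\<^esub>) = p a" by (simp add: f_def)
  ultimately show ?thesis
    unfolding ext_equiv_def using qf
    by (intro bexI[of _ f]) (auto simp: split_extension_def defs)
qed

section \<open>Splitting of t-extensions\<close>

text \<open>For the middle group \<open>B\<close>, the restricted projection from \<open>tB\<close> to \<open>tC = C\<close> is onto, and
  its kernel is the image of the trivial group \<open>tA\<close>; the section is its inverse.\<close>

lemma t_extension_section:
  assumes A: "torsion_free_group A" and C: "torsion_group C" and E: "is_t_extension A C E"
  obtains s where "s \<in> hom C (ext_mid E)" "\<And>c. c \<in> carrier C \<Longrightarrow> ext_proj E (s c) = c"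
proof -
  define B p q where "B = ext_mid E" and "p = ext_inj E" and "q = ext_proj E"
  note defs = B_def p_def q_def
  have groups: "comm_group A" "comm_group B" "comm_group C" and p: "p \<in> hom A B"
    and t: "short_exact (torsion_subgroup A) (torsion_subgroup B) (torsion_subgroup C) p q"
    using E by (auto simp: is_t_extension_def is_extension_def short_exact_def mon_def defs)
  interpret A: comm_group A by fact
  interpret B: comm_group B by fact
  interpret C: comm_group C by fact
  interpret p: group_hom A B p by unfold_locales (rule p)
  let ?T = "torsion_subgroup B"
  interpret T: group ?T by (rule B.subgroup_imp_group[OF B.subgroup_torsion_part])
  have TC: "torsion_subgroup C = C" using C by (simp add: torsion_group_def)
  have q: "q \<in> hom ?T C" "q ` carrier ?T = carrier C"
    using t by (auto simp: TC short_exact_def epi_def)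
  interpret q: group_hom ?T C q by unfold_locales (rule q)
  have "kernel ?T (torsion_subgroup C) q = p ` torsion_part A"
    using t by (simp add: short_exact_def)
  then have "kernel ?T C q = {\<one>\<^bsub>?T\<^esub>}"
    using A by (simp add: TC torsion_free_group_def)
  then have inj: "inj_on q (carrier ?T)" by (rule q.trivial_ker_imp_inj)
  let ?s = "inv_into (carrier ?T) q"
  have "q \<in> iso ?T C" using q inj by (simp add: iso_def bij_betw_def)
  then have "?s \<in> hom C ?T" using T.iso_set_sym[of q C] by (simp add: iso_def)
  then have "?s \<in> hom C B"
    by (auto simp: hom_def torsion_part_def)
  moreover have "q (?s c) = c" if "c \<in> carrier C" for c
    using q(2) that by (metis f_inv_into_f)
  ultimately show thesis using that unfolding defs by blast
qed

theorem lemma2p1: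
  fixes A :: "('a, 'm) monoid_scheme" and C :: "('c, 'n) monoid_scheme"
  assumes "comm_group A" and "torsion_free_group A"
    and "comm_group C" and "torsion_group C"
  shows "carrier (Ext_t C A) = {\<one>\<^bsub>Ext_t C A\<^esub>}"
proof -
  let ?X = "{E :: ('a, 'a \<times> 'c, 'c) extension. is_extension A C E}"
  let ?R = "ext_rel C A :: ('a, 'a \<times> 'c, 'c) extension rel"
  let ?E0 = "split_extension A C"
  let ?S0 = "?R `` {?E0}"
  have E0: "?E0 \<in> ?X" using is_extension_split_extension assms(1,3) by blast
  have carr: "carrier (Ext_t C A) = {S \<in> ?X // ?R. \<exists>E \<in> S. is_t_extension A C E}"
    and one: "\<one>\<^bsub>Ext_t C A\<^esub> = ?S0"
    by (simp_all add: Ext_t_def Ext_def)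
  have "S = ?S0" if S: "S \<in> ?X // ?R" and E: "E \<in> S" "is_t_extension A C E" for S E
  proof -
    have ext: "is_extension A C E" using E(2) by (simp add: is_t_extension_def)
    obtain s where "s \<in> hom C (ext_mid E)" "\<And>c. c \<in> carrier C \<Longrightarrow> ext_proj E (s c) = c"
      using t_extension_section[OF assms(2,4) E(2)] by blast
    then have "ext_equiv A C ?E0 E" by (rule split_extension_equiv_if_section[OF ext])
    then have "(?E0, E) \<in> ?R" using E0 ext by (simp add: ext_rel_def)
    moreover have "?E0 \<in> ?S0" using equiv_ext_rel E0 by (rule equiv_class_self)
    moreover have "?S0 \<in> ?X // ?R" using E0 by (rule quotientI)
    ultimately show ?thesis using quotient_eqI[OF equiv_ext_rel] S E(1) by metis
  qed
  moreover have "?S0 \<in> ?X // ?R" using E0 by (rule quotientI)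
  moreover have "?E0 \<in> ?S0" using equiv_ext_rel E0 by (rule equiv_class_self)
  ultimately show ?thesis
    unfolding carr one using is_t_extension_split_extension[OF assms(1,3)] by blast
qed

end
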